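(* Let $\Bbbk=\mathbb F_2[t_1,t_2,t_3]/(t_1^2,t_2^2,t_3^2)$ and $M=\Bbbk^3/\langle t_1e_1+t_2e_2+t_3e_3\rangle$, where $e_1,e_2,e_3$ is the standard basis of $\Bbbk^3$. Then the map $$\partial:\Lambda^2M\to M\otimes M,\qquad\partial(a\wedge b)=a\otimes b-b\otimes a,$$ is not injective. More precisely, $t_1e_1\wedge t_2e_2$ is a non-trivial element of $\mathrm{Ker}(\partial:\Lambda^2M\to M\otimes M)$.
   Context: Tensor and exterior powers are over $\Bbbk$. *)

theory Defs
  imports
    "HOL-Analysis.Finite_Cartesian_Product"
    "HOL-Library.Numeral_Type"
    "HOL-Library.Poly_Mapping"
    "HOL-Library.Z2"
begin

section \<open>The base ring\<close>

text \<open>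
  \<open>\<F>\<^sub>2[t\<^sub>1, t\<^sub>2, t\<^sub>3]\<close> is the monoid algebra of the exponent vectors \<open>3 \<Rightarrow>\<^sub>0 nat\<close> over the field
  \<open>bit\<close>. The three variables are indexed by the three-element type \<open>3\<close>, whose elements
  are \<open>1\<close>, \<open>2\<close> and \<open>3\<close> (in this type \<open>3 = 0\<close>).
\<close>

type_synonym poly3 = "(3 \<Rightarrow>\<^sub>0 nat) \<Rightarrow>\<^sub>0 bit"

definition X :: "3 \<Rightarrow> poly3"
  where "X i = Poly_Mapping.single (Poly_Mapping.single i 1) 1"

lemma module_mult: "module ((*) :: 'a::comm_ring_1 \<Rightarrow> 'a \<Rightarrow> 'a)"
  by unfold_locales (simp_all add: algebra_simps)

definition square_ideal :: "poly3 set"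
  where "square_ideal = module.span (*) {(X 1)\<^sup>2, (X 2)\<^sup>2, (X 3)\<^sup>2}"

lemma (in module) equivp_mod_span: "equivp (\<lambda>x y. x - y \<in> span S)"
proof (rule equivpI)
  show "reflp (\<lambda>x y. x - y \<in> span S)"
    by (simp add: reflp_def span_zero)
  show "symp (\<lambda>x y. x - y \<in> span S)"
    by (metis (mono_tags, lifting) minus_diff_eq span_neg sympI)
  show "transp (\<lambda>x y. x - y \<in> span S)"
  proof (rule transpI)
    fix x y z assume "x - y \<in> span S" "y - z \<in> span S"
    then have "(x - y) + (y - z) \<in> span S" by (rule span_add)
    then show "x - z \<in> span S" by simp
  qed
qed

lemma (in module) eq_imp_mod_span: "x = y \<Longrightarrow> x - y \<in> span S"
  by (simp add: span_zero)

lemma (in module) span_add_cong: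
  "x - x' \<in> span S \<Longrightarrow> y - y' \<in> span S \<Longrightarrow> (x + y) - (x' + y') \<in> span S"
  using span_add[of "x - x'" S "y - y'"] by (simp add: algebra_simps)

lemma (in module) span_diff_cong:
  "x - x' \<in> span S \<Longrightarrow> y - y' \<in> span S \<Longrightarrow> (x - y) - (x' - y') \<in> span S"
  using span_diff[of "x - x'" S "y - y'"] by (simp add: algebra_simps)

lemma (in module) span_uminus_cong:
  "x - x' \<in> span S \<Longrightarrow> (- x) - (- x') \<in> span S"
  using span_neg[of "x - x'" S] by (simp add: algebra_simps)

lemma (in module) span_scale_cong:
  "x - x' \<in> span S \<Longrightarrow> scale c x - scale c x' \<in> span S"
  using span_scale[of "x - x'" S c] by (simp add: scale_right_diff_distrib)

lemma lookup_mult_0: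
  fixes p q :: poly3
  shows "Poly_Mapping.lookup (p * q) 0 = Poly_Mapping.lookup p 0 * Poly_Mapping.lookup q 0"
proof -
  have *: "(0 = l + m) \<longleftrightarrow> l = 0 \<and> m = 0" for l m :: "3 \<Rightarrow>\<^sub>0 nat"
    by (auto simp: poly_mapping_eq_iff plus_poly_mapping.rep_eq fun_eq_iff)
  have "Sum_any (\<lambda>m. Poly_Mapping.lookup q m when 0 = l + m) = (Poly_Mapping.lookup q 0 when l = 0)" for l
    unfolding * by (cases "l = 0") simp_all
  then have "Poly_Mapping.lookup (p * q) 0
      = Sum_any (\<lambda>l. Poly_Mapping.lookup p l * (Poly_Mapping.lookup q 0 when l = 0))"
    by (simp only: lookup_mult)
  also have "\<dots> = Sum_any (\<lambda>l. (Poly_Mapping.lookup p l * Poly_Mapping.lookup q 0) when l = 0)"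
    by (simp only: mult_when)
  finally show ?thesis by (simp only: Sum_any_when_equal)
qed

lemma one_notin_square_ideal: "1 \<notin> square_ideal"
proof -
  have "module.subspace (*) {p :: poly3. Poly_Mapping.lookup p 0 = 0}"
    by (rule module.subspaceI[OF module_mult]) (auto simp: lookup_add lookup_mult_0)
  moreover have "(X i)\<^sup>2 \<in> {p. Poly_Mapping.lookup p 0 = 0}" for i
  proof -
    have "Poly_Mapping.single i (1::nat) \<noteq> 0"
      by (metis lookup_single_eq lookup_zero zero_neq_one)
    then show ?thesis
      by (simp add: power2_eq_square lookup_mult_0 X_def lookup_single_not_eq)
  qed
  ultimately have "square_ideal \<subseteq> {p. Poly_Mapping.lookup p 0 = 0}"
    unfolding square_ideal_def by (intro module.span_minimal[OF module_mult]) auto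
  then show ?thesis by auto
qed

lemma zero_in_square_ideal: "0 \<in> square_ideal"
  unfolding square_ideal_def by (rule module.span_zero[OF module_mult])

quotient_type kk = poly3 / "\<lambda>p q. p - q \<in> square_ideal"
  unfolding square_ideal_def by (rule module.equivp_mod_span[OF module_mult])

instantiation kk :: comm_ring_1
begin

lift_definition zero_kk :: kk is 0 .
lift_definition one_kk :: kk is 1 .
lift_definition plus_kk :: "kk \<Rightarrow> kk \<Rightarrow> kk" is "(+)"
  unfolding square_ideal_def by (rule module.span_add_cong[OF module_mult])
lift_definition minus_kk :: "kk \<Rightarrow> kk \<Rightarrow> kk" is "(-)"
  unfolding square_ideal_def by (rule module.span_diff_cong[OF module_mult])
lift_definition uminus_kk :: "kk \<Rightarrow> kk" is uminus
  unfolding square_ideal_def by (rule module.span_uminus_cong[OF module_mult])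
lift_definition times_kk :: "kk \<Rightarrow> kk \<Rightarrow> kk" is "(*)"
proof -
  fix p p' q q' :: poly3
  assume "p - p' \<in> square_ideal" "q - q' \<in> square_ideal"
  then have "q * (p - p') + p' * (q - q') \<in> square_ideal"
    unfolding square_ideal_def by (intro module.span_add[OF module_mult] module.span_scale[OF module_mult])
  then show "p * q - p' * q' \<in> square_ideal"
    by (simp add: algebra_simps)
qed

instance
proof
  show "(0::kk) \<noteq> 1"
  proof (transfer, rule notI)
    assume "(0::poly3) - 1 \<in> square_ideal"
    then have "- (0 - 1) \<in> square_ideal"
      unfolding square_ideal_def by (rule module.span_neg[OF module_mult])
    then show False using one_notin_square_ideal by simp
  qed
next
  fix a b c :: kk
  show "a * b * c = a * (b * c)" by transfer (simp add: algebra_simps zero_in_square_ideal)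
  show "a * b = b * a" by transfer (simp add: algebra_simps zero_in_square_ideal)
  show "1 * a = a" by transfer (simp add: zero_in_square_ideal)
  show "a + b + c = a + (b + c)" by transfer (simp add: algebra_simps zero_in_square_ideal)
  show "a + b = b + a" by transfer (simp add: algebra_simps zero_in_square_ideal)
  show "0 + a = a" by transfer (simp add: zero_in_square_ideal)
  show "- a + a = 0" by transfer (simp add: zero_in_square_ideal)
  show "a - b = a + - b" by transfer (simp add: zero_in_square_ideal)
  show "(a + b) * c = a * c + b * c" by transfer (simp add: algebra_simps zero_in_square_ideal)
qed

end

lift_definition t :: "3 \<Rightarrow> kk" is X .


section \<open>Modules over the base ring\<close>

class kk_module = ab_group_add +
  fixes kscale :: "kk \<Rightarrow> 'a \<Rightarrow> 'a"  (infixr \<open>*\<^sub>k\<close> 75)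
  assumes kscale_add_right: "c *\<^sub>k (x + y) = c *\<^sub>k x + c *\<^sub>k y"
    and kscale_add_left: "(c + d) *\<^sub>k x = c *\<^sub>k x + d *\<^sub>k x"
    and kscale_kscale: "c *\<^sub>k (d *\<^sub>k x) = (c * d) *\<^sub>k x"
    and kscale_one: "1 *\<^sub>k x = x"

interpretation kmod: module "kscale :: kk \<Rightarrow> 'a::kk_module \<Rightarrow> 'a"
  by unfold_locales (fact kscale_add_right kscale_add_left kscale_kscale kscale_one)+

instantiation kk :: kk_module
begin
definition kscale_kk :: "kk \<Rightarrow> kk \<Rightarrow> kk" where "kscale_kk = (*)"
instance by standard (simp_all add: kscale_kk_def algebra_simps)
end

instantiation vec :: (kk_module, finite) kk_module
begin
definition kscale_vec :: "kk \<Rightarrow> 'a^'b \<Rightarrow> 'a^'b" where "c *\<^sub>k v = (\<chi> i. c *\<^sub>k v $ i)"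
instance
  by standard (simp_all add: kscale_vec_def vec_eq_iff algebra_simps)
end

text \<open>\<open>'b \<Rightarrow>\<^sub>0 kk\<close> is the free module on the set of all elements of \<open>'b\<close>.\<close>

instantiation poly_mapping :: (type, kk_module) kk_module
begin
definition kscale_poly_mapping :: "kk \<Rightarrow> ('a \<Rightarrow>\<^sub>0 'b) \<Rightarrow> ('a \<Rightarrow>\<^sub>0 'b)"
  where "c *\<^sub>k p = Poly_Mapping.map ((*\<^sub>k) c) p"
instance
proof -
  have *: "Poly_Mapping.lookup (c *\<^sub>k p) x = c *\<^sub>k Poly_Mapping.lookup p x" for c and p :: "'a \<Rightarrow>\<^sub>0 'b" and x
    by (simp add: kscale_poly_mapping_def map.rep_eq when_def)
  show "OFCLASS('a \<Rightarrow>\<^sub>0 'b, kk_module_class)"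
    by (standard; rule poly_mapping_eqI; simp add: * lookup_add algebra_simps)
qed
end

lemma lookup_kscale [simp]: "Poly_Mapping.lookup (c *\<^sub>k p) x = c *\<^sub>k Poly_Mapping.lookup p x"
  by (simp add: kscale_poly_mapping_def map.rep_eq when_def)


section \<open>The module \<open>M\<close>\<close>

quotient_type M = "kk^3" /
  "\<lambda>v w. v - w \<in> kmod.span {t 1 *\<^sub>k axis 1 1 + t 2 *\<^sub>k axis 2 1 + t 3 *\<^sub>k axis 3 1}"
  by (rule kmod.equivp_mod_span)

instantiation M :: kk_module
begin

lift_definition zero_M :: M is 0 .
lift_definition plus_M :: "M \<Rightarrow> M \<Rightarrow> M" is "(+)" by (rule kmod.span_add_cong)
lift_definition minus_M :: "M \<Rightarrow> M \<Rightarrow> M" is "(-)" by (rule kmod.span_diff_cong)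
lift_definition uminus_M :: "M \<Rightarrow> M" is uminus by (rule kmod.span_uminus_cong)
lift_definition kscale_M :: "kk \<Rightarrow> M \<Rightarrow> M" is kscale by (rule kmod.span_scale_cong)

instance
proof
  fix x y z :: "M" and c d :: kk
  show "x + y + z = x + (y + z)"
    by transfer (rule kmod.eq_imp_mod_span, simp add: algebra_simps)
  show "x + y = y + x"
    by transfer (rule kmod.eq_imp_mod_span, simp add: algebra_simps)
  show "0 + x = x"
    by transfer (rule kmod.eq_imp_mod_span, simp add: algebra_simps)
  show "- x + x = 0"
    by transfer (rule kmod.eq_imp_mod_span, simp add: algebra_simps)
  show "x - y = x + - y"
    by transfer (rule kmod.eq_imp_mod_span, simp add: algebra_simps)
  show "c *\<^sub>k (x + y) = c *\<^sub>k x + c *\<^sub>k y"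
    by transfer (rule kmod.eq_imp_mod_span, simp add: algebra_simps)
  show "(c + d) *\<^sub>k x = c *\<^sub>k x + d *\<^sub>k x"
    by transfer (rule kmod.eq_imp_mod_span, simp add: algebra_simps)
  show "c *\<^sub>k d *\<^sub>k x = (c * d) *\<^sub>k x"
    by transfer (rule kmod.eq_imp_mod_span, simp add: algebra_simps)
  show "1 *\<^sub>k x = x"
    by transfer (rule kmod.eq_imp_mod_span, simp add: algebra_simps)
qed

end

text \<open>The class in \<open>M\<close> of the standard basis vector.\<close>

lift_definition e :: "3 \<Rightarrow> M" is "\<lambda>i. axis i 1" .


section \<open>Tensor products and exterior squares over the base ring\<close>

abbreviation free_gen :: "'b \<Rightarrow> ('b \<Rightarrow>\<^sub>0 kk)"
  where "free_gen x \<equiv> Poly_Mapping.single x 1"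

definition tensor_rels :: "('a::kk_module \<times> 'b::kk_module \<Rightarrow>\<^sub>0 kk) set"
  where "tensor_rels =
      {free_gen (a + a', b) - (free_gen (a, b) + free_gen (a', b)) | a a' b. True}
    \<union> {free_gen (a, b + b') - (free_gen (a, b) + free_gen (a, b')) | a b b'. True}
    \<union> {free_gen (c *\<^sub>k a, b) - c *\<^sub>k free_gen (a, b) | c a b. True}
    \<union> {free_gen (a, c *\<^sub>k b) - c *\<^sub>k free_gen (a, b) | c a b. True}"

quotient_type (overloaded) ('a, 'b) tensor = "'a::kk_module \<times> 'b::kk_module \<Rightarrow>\<^sub>0 kk" /
  "\<lambda>p q. p - q \<in> kmod.span tensor_rels"
  by (rule kmod.equivp_mod_span)

instantiation tensor :: (kk_module, kk_module) kk_module
begin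

lift_definition zero_tensor :: "('a, 'b) tensor" is 0 .
lift_definition plus_tensor :: "('a, 'b) tensor \<Rightarrow> ('a, 'b) tensor \<Rightarrow> ('a, 'b) tensor" is "(+)"
  by (rule kmod.span_add_cong)
lift_definition minus_tensor :: "('a, 'b) tensor \<Rightarrow> ('a, 'b) tensor \<Rightarrow> ('a, 'b) tensor" is "(-)"
  by (rule kmod.span_diff_cong)
lift_definition uminus_tensor :: "('a, 'b) tensor \<Rightarrow> ('a, 'b) tensor" is uminus
  by (rule kmod.span_uminus_cong)
lift_definition kscale_tensor :: "kk \<Rightarrow> ('a, 'b) tensor \<Rightarrow> ('a, 'b) tensor" is kscale
  by (rule kmod.span_scale_cong)

instance
proof
  fix x y z :: "('a, 'b) tensor" and c d :: kk
  show "x + y + z = x + (y + z)"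
    by transfer (rule kmod.eq_imp_mod_span, simp add: algebra_simps)
  show "x + y = y + x"
    by transfer (rule kmod.eq_imp_mod_span, simp add: algebra_simps)
  show "0 + x = x"
    by transfer (rule kmod.eq_imp_mod_span, simp add: algebra_simps)
  show "- x + x = 0"
    by transfer (rule kmod.eq_imp_mod_span, simp add: algebra_simps)
  show "x - y = x + - y"
    by transfer (rule kmod.eq_imp_mod_span, simp add: algebra_simps)
  show "c *\<^sub>k (x + y) = c *\<^sub>k x + c *\<^sub>k y"
    by transfer (rule kmod.eq_imp_mod_span, simp add: algebra_simps)
  show "(c + d) *\<^sub>k x = c *\<^sub>k x + d *\<^sub>k x"
    by transfer (rule kmod.eq_imp_mod_span, simp add: algebra_simps)
  show "c *\<^sub>k d *\<^sub>k x = (c * d) *\<^sub>k x"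
    by transfer (rule kmod.eq_imp_mod_span, simp add: algebra_simps)
  show "1 *\<^sub>k x = x"
    by transfer (rule kmod.eq_imp_mod_span, simp add: algebra_simps)
qed

end

lift_definition tensor_of :: "'a::kk_module \<Rightarrow> 'b::kk_module \<Rightarrow> ('a, 'b) tensor"  (infixl \<open>\<otimes>\<close> 70)
  is "\<lambda>a b. free_gen (a, b)" .

text \<open>The relations \<open>a \<otimes> a = 0\<close>, and not merely antisymmetry, are imposed: the base ring has
  characteristic two.\<close>

quotient_type (overloaded) 'a ext2 = "('a::kk_module, 'a) tensor" /
  "\<lambda>x y. x - y \<in> kmod.span {a \<otimes> a | a. True}"
  by (rule kmod.equivp_mod_span)

instantiation ext2 :: (kk_module) kk_module
begin

lift_definition zero_ext2 :: "'a ext2" is 0 .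
lift_definition plus_ext2 :: "'a ext2 \<Rightarrow> 'a ext2 \<Rightarrow> 'a ext2" is "(+)"
  by (rule kmod.span_add_cong)
lift_definition minus_ext2 :: "'a ext2 \<Rightarrow> 'a ext2 \<Rightarrow> 'a ext2" is "(-)"
  by (rule kmod.span_diff_cong)
lift_definition uminus_ext2 :: "'a ext2 \<Rightarrow> 'a ext2" is uminus
  by (rule kmod.span_uminus_cong)
lift_definition kscale_ext2 :: "kk \<Rightarrow> 'a ext2 \<Rightarrow> 'a ext2" is kscale
  by (rule kmod.span_scale_cong)

instance
proof
  fix x y z :: "'a ext2" and c d :: kk
  show "x + y + z = x + (y + z)"
    by transfer (rule kmod.eq_imp_mod_span, simp add: algebra_simps)
  show "x + y = y + x"
    by transfer (rule kmod.eq_imp_mod_span, simp add: algebra_simps)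
  show "0 + x = x"
    by transfer (rule kmod.eq_imp_mod_span, simp add: algebra_simps)
  show "- x + x = 0"
    by transfer (rule kmod.eq_imp_mod_span, simp add: algebra_simps)
  show "x - y = x + - y"
    by transfer (rule kmod.eq_imp_mod_span, simp add: algebra_simps)
  show "c *\<^sub>k (x + y) = c *\<^sub>k x + c *\<^sub>k y"
    by transfer (rule kmod.eq_imp_mod_span, simp add: algebra_simps)
  show "(c + d) *\<^sub>k x = c *\<^sub>k x + d *\<^sub>k x"
    by transfer (rule kmod.eq_imp_mod_span, simp add: algebra_simps)
  show "c *\<^sub>k d *\<^sub>k x = (c * d) *\<^sub>k x"
    by transfer (rule kmod.eq_imp_mod_span, simp add: algebra_simps)
  show "1 *\<^sub>k x = x"
    by transfer (rule kmod.eq_imp_mod_span, simp add: algebra_simps)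
qed

end

lift_definition wedge :: "'a::kk_module \<Rightarrow> 'a \<Rightarrow> 'a ext2"  (infixl \<open>\<and>\<^sub>k\<close> 70)
  is "\<lambda>a b. a \<otimes> b" .

abbreviation kk_linear :: "('a::kk_module \<Rightarrow> 'b::kk_module) \<Rightarrow> bool"
  where "kk_linear \<equiv> module_hom kscale kscale"

lemma kk_linearI:
  fixes f :: "'a::kk_module \<Rightarrow> 'b::kk_module"
  assumes "\<And>x y. f (x + y) = f x + f y" and "\<And>c x. f (c *\<^sub>k x) = c *\<^sub>k f x"
  shows "kk_linear f"
  using assms by unfold_locales

lemma quotient_lift:
  fixes f :: "'a::kk_module \<Rightarrow> 'c::kk_module" and abs :: "'a \<Rightarrow> 'b::kk_module"
  assumes f: "kk_linear f" and f0: "\<And>x. x \<in> S \<Longrightarrow> f x = 0"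
    and rep: "\<And>x. rep (abs x) - x \<in> kmod.span S" and surj: "\<And>y. abs (rep y) = y"
    and add: "\<And>x y. abs x + abs y = abs (x + y)"
    and scale: "\<And>c x. c *\<^sub>k abs x = abs (c *\<^sub>k x)"
  shows "kk_linear (\<lambda>y. f (rep y)) \<and> (\<forall>x. f (rep (abs x)) = f x)"
proof -
  interpret f: module_hom kscale kscale f by (fact f)
  have eq: "f (rep (abs x)) = f x" for x
  proof -
    have "f (rep (abs x) - x) = 0" by (rule f.eq_0_on_span[OF f0 rep])
    then show ?thesis by (simp add: f.diff)
  qed
  have "kk_linear (\<lambda>y. f (rep y))"
  proof (rule kk_linearI)
    show "f (rep (x + y)) = f (rep x) + f (rep y)" for x y
      using eq[of "rep x + rep y"] by (simp add: add[symmetric] surj f.add)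
    show "f (rep (c *\<^sub>k x)) = c *\<^sub>k f (rep x)" for c x
      using eq[of "c *\<^sub>k rep x"] by (simp add: scale[symmetric] surj f.scale)
  qed
  with eq show ?thesis by simp
qed

lemma free_universal:
  fixes f :: "'x \<Rightarrow> 'a::kk_module"
  shows "\<exists>F. kk_linear F \<and> (\<forall>x. F (free_gen x) = f x)"
proof -
  define F where "F p = (\<Sum>x\<in>Poly_Mapping.keys p. Poly_Mapping.lookup p x *\<^sub>k f x)" for p
  have F: "F p = (\<Sum>x\<in>A. Poly_Mapping.lookup p x *\<^sub>k f x)"
    if "finite A" "Poly_Mapping.keys p \<subseteq> A" for p A
    unfolding F_def using that by (intro sum.mono_neutral_left) (auto simp: in_keys_iff)
  have "kk_linear F"
  proof (rule kk_linearI)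
    fix p q :: "'x \<Rightarrow>\<^sub>0 kk"
    let ?A = "Poly_Mapping.keys p \<union> Poly_Mapping.keys q"
    have "Poly_Mapping.keys (p + q) \<subseteq> ?A" by (rule Poly_Mapping.keys_add)
    then show "F (p + q) = F p + F q"
      by (simp add: F[of ?A] lookup_add kmod.scale_left_distrib sum.distrib)
  next
    fix c and p :: "'x \<Rightarrow>\<^sub>0 kk"
    have "Poly_Mapping.keys (c *\<^sub>k p) \<subseteq> Poly_Mapping.keys p"
      by (auto simp: in_keys_iff)
    then show "F (c *\<^sub>k p) = c *\<^sub>k F p"
      by (simp add: F[of "Poly_Mapping.keys p"] kmod.scale_sum_right kscale_kk_def)
  qed
  moreover have "F (free_gen x) = f x" for x
    by (simp add: F_def)
  ultimately show ?thesis by blast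
qed

lemma tensor_universal:
  fixes f :: "'a::kk_module \<Rightarrow> 'b::kk_module \<Rightarrow> 'c::kk_module"
  assumes "\<And>b. kk_linear (\<lambda>a. f a b)" and "\<And>a. kk_linear (f a)"
  shows "\<exists>g. kk_linear g \<and> (\<forall>a b. g (a \<otimes> b) = f a b)"
proof -
  obtain F where F: "kk_linear F" "\<And>x. F (free_gen x) = (case x of (a, b) \<Rightarrow> f a b)"
    using free_universal[of "\<lambda>(a, b). f a b"] by blast
  interpret F: module_hom kscale kscale F by (fact F)
  have "F x = 0" if "x \<in> tensor_rels" for x
    using that unfolding tensor_rels_def
    by (auto simp: F.diff F.add F.scale F(2) module_hom.add[OF assms(2)]
        module_hom.scale[OF assms(2)] module_hom.add[OF assms(1)] module_hom.scale[OF assms(1)])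
  then have "kk_linear (\<lambda>y. F (rep_tensor y)) \<and> (\<forall>x. F (rep_tensor (abs_tensor x)) = F x)"
    by (intro quotient_lift[OF F(1), where S = tensor_rels])
      (use Quotient_rep_abs[OF Quotient_tensor] Quotient_abs_rep[OF Quotient_tensor]
        in \<open>auto simp: plus_tensor.abs_eq kscale_tensor.abs_eq kmod.span_zero\<close>)
  then show ?thesis
    by (intro exI[of _ "\<lambda>y. F (rep_tensor y)"]) (auto simp: tensor_of.abs_eq F(2))
qed

lemma ext2_universal:
  fixes f :: "'a::kk_module \<Rightarrow> 'a \<Rightarrow> 'c::kk_module"
  assumes "\<And>b. kk_linear (\<lambda>a. f a b)" and "\<And>a. kk_linear (f a)" and "\<And>a. f a a = 0"
  shows "\<exists>g. kk_linear g \<and> (\<forall>a b. g (a \<and>\<^sub>k b) = f a b)"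
proof -
  obtain F where F: "kk_linear F" "\<And>a b. F (a \<otimes> b) = f a b"
    using tensor_universal[of f] assms by blast
  have "kk_linear (\<lambda>y. F (rep_ext2 y)) \<and> (\<forall>x. F (rep_ext2 (abs_ext2 x)) = F x)"
    by (intro quotient_lift[OF F(1), where S = "{a \<otimes> a | a. True}"])
      (use Quotient_rep_abs[OF Quotient_ext2] Quotient_abs_rep[OF Quotient_ext2]
        in \<open>auto simp: plus_ext2.abs_eq kscale_ext2.abs_eq kmod.span_zero F assms\<close>)
  then show ?thesis
    by (intro exI[of _ "\<lambda>y. F (rep_ext2 y)"]) (auto simp: wedge.abs_eq F)
qed

lemma free_linear_eqI:
  fixes F G :: "('x \<Rightarrow>\<^sub>0 kk) \<Rightarrow> 'a::kk_module"
  assumes "kk_linear F" "kk_linear G" "\<And>x. F (free_gen x) = G (free_gen x)"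
  shows "F = G"
proof
  fix p :: "'x \<Rightarrow>\<^sub>0 kk"
  interpret F: module_hom kscale kscale F by (fact assms)
  interpret G: module_hom kscale kscale G by (fact assms)
  have p: "p = (\<Sum>x\<in>Poly_Mapping.keys p. Poly_Mapping.lookup p x *\<^sub>k free_gen x)"
    by (rule poly_mapping_eqI)
      (auto simp: lookup_sum lookup_single when_def kscale_kk_def if_distrib in_keys_iff cong: if_cong)
  show "F p = G p"
    by (subst (1 2) p) (simp add: F.sum G.sum F.scale G.scale assms(3))
qed

lemma tensor_linear_eqI:
  fixes f g :: "('a::kk_module, 'b::kk_module) tensor \<Rightarrow> 'c::kk_module"
  assumes "kk_linear f" "kk_linear g" "\<And>a b. f (a \<otimes> b) = g (a \<otimes> b)"
  shows "f = g"
proof -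
  have abs: "kk_linear (abs_tensor :: _ \<Rightarrow> ('a, 'b) tensor)"
    by (rule kk_linearI) (simp_all add: plus_tensor.abs_eq kscale_tensor.abs_eq)
  have "f \<circ> abs_tensor = g \<circ> abs_tensor"
    by (rule free_linear_eqI)
      (use assms in \<open>auto intro!: module_hom_compose[OF abs] simp: tensor_of.abs_eq[symmetric]\<close>)
  then have "f (abs_tensor p) = g (abs_tensor p)" for p by (metis comp_apply)
  then show ?thesis by (metis Quotient_abs_rep[OF Quotient_tensor] ext)
qed

lemma ext2_linear_eqI:
  fixes f g :: "'a::kk_module ext2 \<Rightarrow> 'c::kk_module"
  assumes "kk_linear f" "kk_linear g" "\<And>a b. f (a \<and>\<^sub>k b) = g (a \<and>\<^sub>k b)"
  shows "f = g"
proof -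
  have abs: "kk_linear (abs_ext2 :: _ \<Rightarrow> 'a ext2)"
    by (rule kk_linearI) (simp_all add: plus_ext2.abs_eq kscale_ext2.abs_eq)
  have "f \<circ> abs_ext2 = g \<circ> abs_ext2"
    by (rule tensor_linear_eqI)
      (use assms in \<open>auto intro!: module_hom_compose[OF abs] simp: wedge.abs_eq[symmetric]\<close>)
  then have "f (abs_ext2 p) = g (abs_ext2 p)" for p by (metis comp_apply)
  then show ?thesis by (metis Quotient_abs_rep[OF Quotient_ext2] ext)
qed

lemma tensor_add_left: "(a + a') \<otimes> b = a \<otimes> b + a' \<otimes> b"
  by transfer (rule kmod.span_base, unfold tensor_rels_def, blast)

lemma tensor_add_right: "a \<otimes> (b + b') = a \<otimes> b + a \<otimes> b'"
  by transfer (rule kmod.span_base, unfold tensor_rels_def, blast)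

lemma tensor_scale_left: "(c *\<^sub>k a) \<otimes> b = c *\<^sub>k (a \<otimes> b)"
  by transfer (rule kmod.span_base, unfold tensor_rels_def, blast)

lemma tensor_scale_right: "a \<otimes> (c *\<^sub>k b) = c *\<^sub>k (a \<otimes> b)"
  by transfer (rule kmod.span_base, unfold tensor_rels_def, blast)

lemma ex1_ext2_to_tensor:
  "\<exists>!f :: 'a::kk_module ext2 \<Rightarrow> ('a, 'a) tensor.
     kk_linear f \<and> (\<forall>a b. f (a \<and>\<^sub>k b) = a \<otimes> b - b \<otimes> a)"
proof (rule ex_ex1I)
  show "\<exists>f :: 'a ext2 \<Rightarrow> ('a, 'a) tensor.
      kk_linear f \<and> (\<forall>a b. f (a \<and>\<^sub>k b) = a \<otimes> b - b \<otimes> a)"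
    by (rule ext2_universal; (rule kk_linearI)?)
      (simp_all add: tensor_add_left tensor_add_right tensor_scale_left tensor_scale_right
        kmod.scale_right_diff_distrib)
qed (auto intro: ext2_linear_eqI)

definition ext2_to_tensor :: "'a::kk_module ext2 \<Rightarrow> ('a, 'a) tensor"  (\<open>\<partial>\<close>)
  where "\<partial> = (THE f. kk_linear f \<and> (\<forall>a b. f (a \<and>\<^sub>k b) = a \<otimes> b - b \<otimes> a))"

lemma ext2_to_tensor_linear: "kk_linear \<partial>"
  and ext2_to_tensor_wedge: "\<partial> (a \<and>\<^sub>k b) = a \<otimes> b - b \<otimes> a"
  using theI'[OF ex1_ext2_to_tensor] unfolding ext2_to_tensor_def by blast+

end

theory Submission
  imports Defs "HOL-Analysis.Cartesian_Space"
begin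

text \<open>
  The alternating form \<open>(v, w) \<mapsto> det (t, v, w)\<close> on \<open>\<Bbbk>\<^sup>3\<close> vanishes when one argument is the
  vector \<open>t = (t\<^sub>1, t\<^sub>2, t\<^sub>3)\<close>, hence descends to \<open>\<Lambda>\<^sup>2M\<close>. It takes the value
  \<open>t\<^sub>1t\<^sub>2t\<^sub>3 \<noteq> 0\<close> at \<open>t\<^sub>1e\<^sub>1 \<and> t\<^sub>2e\<^sub>2\<close>. On the other hand, writing \<open>x\<^sub>i = t\<^sub>ie\<^sub>i\<close>, we have
  \<open>x\<^sub>i \<otimes> x\<^sub>i = t\<^sub>i\<^sup>2 (e\<^sub>i \<otimes> e\<^sub>i) = 0\<close>, \<open>x\<^sub>1 + x\<^sub>2 + x\<^sub>3 = 0\<close> and characteristic two, so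
  \<open>x\<^sub>1 \<otimes> x\<^sub>2 = x\<^sub>3 \<otimes> x\<^sub>2 = x\<^sub>3 \<otimes> x\<^sub>1 = x\<^sub>2 \<otimes> x\<^sub>1\<close>.
\<close>

lemma lookup_mult_eq_0:
  fixes p q :: poly3
  assumes "\<And>k l. m = k + l \<Longrightarrow> Poly_Mapping.lookup q l = 0"
  shows "Poly_Mapping.lookup (p * q) m = 0"
proof -
  have "(Poly_Mapping.lookup q l when m = k + l) = 0" for k l
    using assms by (auto simp: when_def)
  then show ?thesis by (simp add: lookup_mult)
qed

text \<open>Divisors of squarefree monomials are squarefree, so the polynomials with no squarefree
  terms form an ideal. It contains the generators \<open>(X i)\<^sup>2\<close>.\<close>

lemma square_ideal_lookup_squarefree:
  assumes "p \<in> square_ideal" and m: "\<And>i. Poly_Mapping.lookup m i \<le> 1"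
  shows "Poly_Mapping.lookup p m = 0"
proof -
  let ?S = "{p :: poly3. \<forall>m. (\<forall>i. Poly_Mapping.lookup m i \<le> 1) \<longrightarrow> Poly_Mapping.lookup p m = 0}"
  have "module.subspace (*) ?S"
  proof (rule module.subspaceI[OF module_mult])
    fix c p :: poly3
    assume p: "p \<in> ?S"
    have "Poly_Mapping.lookup (c * p) m = 0" if "\<forall>i. Poly_Mapping.lookup m i \<le> 1" for m
    proof (rule lookup_mult_eq_0)
      fix k l :: "3 \<Rightarrow>\<^sub>0 nat"
      assume "m = k + l"
      with that have "\<forall>i. Poly_Mapping.lookup l i \<le> 1"
        by (metis add_leD2 lookup_add)
      with p show "Poly_Mapping.lookup p l = 0" by blast
    qed
    then show "c * p \<in> ?S" by blast
  qed (auto simp: lookup_add)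
  moreover have "(X i)\<^sup>2 \<in> ?S" for i
  proof -
    have "\<not> (\<forall>j. Poly_Mapping.lookup (Poly_Mapping.single i 1 + Poly_Mapping.single i (1::nat)) j \<le> 1)"
      by (auto simp: lookup_add intro!: exI[of _ i])
    then show ?thesis
      by (auto simp: power2_eq_square X_def mult_single lookup_single when_def)
  qed
  ultimately have "square_ideal \<subseteq> ?S"
    unfolding square_ideal_def by (intro module.span_minimal[OF module_mult]) auto
  with assms show ?thesis by blast
qed

lemma t_square: "t i * t i = 0"
proof transfer
  fix i :: 3
  have "i \<in> {1, 2, 3}"
    using UNIV_3 by blast
  then have "(X i)\<^sup>2 \<in> square_ideal"
    unfolding square_ideal_def by (auto intro: module.span_base[OF module_mult])
  then show "X i * X i - 0 \<in> square_ideal" by (simp add: power2_eq_square)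
qed

text \<open>The product is a squarefree monomial with coefficient 1, which no element of
  \<open>square_ideal\<close> can contain.\<close>

lemma t_prod_nonzero: "t 1 * t 2 * t 3 \<noteq> 0"
proof (transfer, rule notI)
  let ?m = "Poly_Mapping.single 1 1 + Poly_Mapping.single 2 1 + Poly_Mapping.single 3 (1::nat) :: 3 \<Rightarrow>\<^sub>0 nat"
  assume "X 1 * X 2 * X 3 - 0 \<in> square_ideal"
  then have "Poly_Mapping.lookup (X 1 * X 2 * X 3) ?m = 0"
    by (intro square_ideal_lookup_squarefree) (auto simp: lookup_add lookup_single when_def)
  then show False by (simp add: X_def mult_single)
qed

lemma kk_add_self: "x + x = (0::kk)"
proof transfer
  fix x :: poly3
  have "b + b = 0" for b :: bit by (cases b) simp_all
  then have "x + x = 0" by (intro poly_mapping_eqI) (simp only: lookup_add lookup_zero)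
  then show "x + x - 0 \<in> square_ideal" by (simp only: diff_zero zero_in_square_ideal)
qed

lemma kk_module_add_self: "x + x = (0::'a::kk_module)"
  using kscale_add_left[of 1 1 x] by (simp add: kk_add_self kscale_one)

text \<open>Cofactor expansion of the determinant along its first row
  \<open>(t 1, t 2, t 3)\<close>.\<close>

definition det_form :: "kk^3 \<Rightarrow> kk^3 \<Rightarrow> kk"
  where "det_form v w = t 1 * (v $ 2 * w $ 3 - v $ 3 * w $ 2)
    + t 2 * (v $ 3 * w $ 1 - v $ 1 * w $ 3) + t 3 * (v $ 1 * w $ 2 - v $ 2 * w $ 1)"

lemma det_form_add_left: "det_form (v + v') w = det_form v w + det_form v' w"
  and det_form_add_right: "det_form v (w + w') = det_form v w + det_form v w'"
  and det_form_scale_left: "det_form (c *\<^sub>k v) w = c *\<^sub>k det_form v w"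
  and det_form_scale_right: "det_form v (c *\<^sub>k w) = c *\<^sub>k det_form v w"
  and det_form_self: "det_form v v = 0"
  by (simp_all add: det_form_def kscale_vec_def kscale_kk_def algebra_simps)

lemma det_form_linear: "kk_linear (\<lambda>v. det_form v w)" "kk_linear (det_form v)"
  by (rule kk_linearI;
      simp add: det_form_add_left det_form_add_right det_form_scale_left det_form_scale_right)+

abbreviation rel_vec :: "kk^3"
  where "rel_vec \<equiv> t 1 *\<^sub>k axis 1 1 + t 2 *\<^sub>k axis 2 1 + t 3 *\<^sub>k axis 3 1"

text \<open>A determinant with two equal rows: \<open>rel_vec\<close> is the first row
  again.\<close>

lemma det_form_rel: "det_form rel_vec w = 0" "det_form v rel_vec = 0"
  by (simp_all add: det_form_def kscale_vec_def kscale_kk_def axis_def algebra_simps)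

lift_definition M_form :: "M \<Rightarrow> M \<Rightarrow> kk" is det_form
proof -
  fix v v' w w' :: "kk^3"
  assume v: "v - v' \<in> kmod.span {rel_vec}" and w: "w - w' \<in> kmod.span {rel_vec}"
  \<comment> \<open>The arguments are replaced one at a time, passing through
    \<open>det_form v' w\<close>.\<close>
  have "det_form (v - v') w = 0"
    by (rule module_hom.eq_0_on_span[OF det_form_linear(1) _ v]) (simp add: det_form_rel)
  moreover have "det_form v' (w - w') = 0"
    by (rule module_hom.eq_0_on_span[OF det_form_linear(2) _ w]) (simp add: det_form_rel)
  ultimately show "det_form v w = det_form v' w'"
    using det_form_add_left[of "v - v'" v' w] det_form_add_right[of v' "w - w'" w'] by simp
qed

lemma wedge_t_e_nonzero: "(t 1 *\<^sub>k e 1) \<and>\<^sub>k (t 2 *\<^sub>k e 2) \<noteq> 0"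
proof
  assume eq: "(t 1 *\<^sub>k e 1) \<and>\<^sub>k (t 2 *\<^sub>k e 2) = 0"
  have "kk_linear (\<lambda>a. M_form a b)" "kk_linear (M_form a)" for a b
    by (rule kk_linearI; transfer;
        simp add: det_form_add_left det_form_add_right det_form_scale_left det_form_scale_right)+
  moreover have "M_form a a = 0" for a
    by transfer (rule det_form_self)
  ultimately obtain g where g: "kk_linear g" "\<And>a b. g (a \<and>\<^sub>k b) = M_form a b"
    using ext2_universal[of M_form] by blast
  \<comment> \<open>Only the cofactor of \<open>t 3\<close> survives on these two vectors.\<close>
  have "M_form (t 1 *\<^sub>k e 1) (t 2 *\<^sub>k e 2) = t 1 * t 2 * t 3"
    by transfer (simp add: det_form_def kscale_vec_def kscale_kk_def axis_def algebra_simps)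
  moreover have "g 0 = 0" by (rule module_hom.zero[OF g(1)])
  ultimately show False using g(2) eq t_prod_nonzero by metis
qed

lemma M_relation: "t 1 *\<^sub>k e 1 + t 2 *\<^sub>k e 2 + t 3 *\<^sub>k e 3 = 0"
  by transfer (simp add: kmod.span_base)

lemma tensor_t_e_self: "(t i *\<^sub>k e i) \<otimes> (t i *\<^sub>k e i) = 0"
  by (simp add: tensor_scale_left tensor_scale_right kscale_kscale t_square)

lemma ext2_to_tensor_t_e: "\<partial> ((t 1 *\<^sub>k e 1) \<and>\<^sub>k (t 2 *\<^sub>k e 2)) = 0"
proof -
  define x where "x i = t i *\<^sub>k e i" for i
  have self: "x i \<otimes> x i = 0" for i
    unfolding x_def by (rule tensor_t_e_self)
  have double: "y + y = 0" for y :: M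
    by (rule kk_module_add_self)
  have rel: "x 1 + x 2 + x 3 = 0"
    unfolding x_def by (rule M_relation)
  \<comment> \<open>Cancel \<open>a\<close> in \<open>a + (b + c) = 0 = a + a\<close>.\<close>
  have sub: "b + c = a" if "a + b + c = 0" for a b c :: M
    using that double[of a] by (metis add.assoc add_left_cancel)
  have x1: "x 1 = x 2 + x 3" and x2: "x 2 = x 3 + x 1" and x3: "x 3 = x 1 + x 2"
    using sub[of "x 1" "x 2" "x 3"] sub[of "x 2" "x 3" "x 1"] sub[of "x 3" "x 1" "x 2"] rel
    by (simp_all only: ac_simps)
  \<comment> \<open>Each step expands one factor as the sum of the other two; the resulting
    \<open>x i \<otimes> x i\<close> vanishes.\<close>
  have "x 1 \<otimes> x 2 = x 3 \<otimes> x 2"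
    by (subst x1) (simp add: tensor_add_left self)
  also have "\<dots> = x 3 \<otimes> x 1"
    by (subst x2) (simp add: tensor_add_right self)
  also have "\<dots> = x 2 \<otimes> x 1"
    by (subst x3) (simp add: tensor_add_left self)
  finally show ?thesis
    by (simp add: ext2_to_tensor_wedge x_def)
qed

theorem corollary5p9:
  shows "\<not> inj (\<partial> :: M ext2 \<Rightarrow> (M, M) tensor)
    \<and> (t 1 *\<^sub>k e 1) \<and>\<^sub>k (t 2 *\<^sub>k e 2) \<noteq> 0
    \<and> \<partial> ((t 1 *\<^sub>k e 1) \<and>\<^sub>k (t 2 *\<^sub>k e 2)) = 0"
proof -
  have "\<partial> (0 :: M ext2) = 0"
    by (rule module_hom.zero[OF ext2_to_tensor_linear])
  \<comment> \<open>The nonzero wedge and 0 have the same image.\<close>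
  then have "\<not> inj (\<partial> :: M ext2 \<Rightarrow> (M, M) tensor)"
    using wedge_t_e_nonzero ext2_to_tensor_t_e by (metis injD)
  then show ?thesis
    using wedge_t_e_nonzero ext2_to_tensor_t_e by blast
qed

end
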